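(* Let $(\mu_\lambda(dx))_{\lambda>0}$ be a convolution semigroup of positive measures on $\mathbb{R}^n$ such that $0\in\Theta(\mu_\lambda)$. Assume that $\mu_\lambda(dx)$ has density $f(\lambda,x)$ and, for $c\in\mathbb{R}^n$, consider the density on $\mathbb{R}^n$ defined by $$p(\lambda,c,x)=\frac{\lambda}{\lambda+\langle c,x\rangle}\,f(\lambda+\langle c,x\rangle,x)\,1_{(0,\infty)}(\lambda+\langle c,x\rangle).$$ Then, if $c\neq0$, for $\lambda>0$ and $x\in\mathbb{R}^n$ $$p(\lambda,c,x)\,1_{(0,\infty)}(\langle c,x\rangle)=\int_{\mathbb{R}^n}p(\lambda,0,y)\,p(\langle c,y\rangle,c,x-y)\,dy.$$
   Context: $\langle\cdot,\cdot\rangle$ is the canonical scalar product of $\mathbb{R}^n$. For a positive measure $\mu$, $\Theta(\mu)$ is the interior of $\{\theta\in\mathbb{R}^n:\int e^{\langle\theta,x\rangle}\mu(dx)<\infty\}$. Convolution semigroup means $\mu_\lambda*\mu_{\lambda'}=\mu_{\lambda+\lambda'}$ for all $\lambda,\lambda'>0$; equivalently, with $L_\lambda$ the Laplace transform of $\mu_\lambda$, $L_\lambda=(L_1)^\lambda$. Densities are with respect to Lebesgue measure. The formula defining $p(\lambda,c,x)$ is also used when its first argument is an arbitrary real number (such as $\langle c,y\rangle$), the value being $0$ when the indicator vanishes; thus $p(\langle c,y\rangle,c,x-y)=\frac{\langle c,y\rangle}{\langle c,x\rangle}f(\langle c,x\rangle,x-y)1_{(0,\infty)}(\langle c,x\r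angle)$.
   Formalization: Claim fails for arbitrary versions of f. Proved: f≥0 jointly Borel; identity for a.e. (λ,x), and at every λ>0, x where the integral converges absolutely and, if ⟨c,x⟩>0, f(λ+⟨c,x⟩,x) is the value at x of the convolution f(λ,·)*f(⟨c,x⟩,·). *)

theory Defs
  imports "HOL-Probability.Probability"
begin

definition Theta :: "(real ^ 'n) measure \<Rightarrow> (real ^ 'n) set" where
  "Theta \<mu> = interior {\<theta>. (\<integral>\<^sup>+ x. ennreal (exp (\<theta> \<bullet> x)) \<partial>\<mu>) < \<infinity>}"

definition convolution_semigroup :: "(real \<Rightarrow> (real ^ 'n) measure) \<Rightarrow> bool" where
  "convolution_semigroup \<mu> \<longleftrightarrow>
     (\<forall>l>0. sets (\<mu> l) = sets borel) \<and> (\<forall>l>0. \<forall>l'>0. (\<mu> l \<star> \<mu> l') = \<mu> (l + l'))"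

text \<open>The last conjunct (joint measurability in both arguments) is what makes
  \<open>x \<mapsto> f (l + c \<bullet> x) x\<close> a measurable function. The values \<open>f l x\<close> with
  \<open>l \<le> 0\<close> are unconstrained.\<close>

definition has_densities ::
    "(real \<Rightarrow> (real ^ 'n) measure) \<Rightarrow> (real \<Rightarrow> real ^ 'n \<Rightarrow> real) \<Rightarrow> bool" where
  "has_densities \<mu> f \<longleftrightarrow>
     (\<forall>l>0. f l \<in> borel_measurable borel \<and> (\<forall>x. 0 \<le> f l x) \<and>
            \<mu> l = density lborel (\<lambda>x. ennreal (f l x))) \<and>
     set_borel_measurable borel ({0<..} \<times> UNIV) (\<lambda>(l, x). f l x)"

text \<open>The first parameter \<open>l\<close> ranges over all reals. Where \<open>l + c \<bullet> x \<le> 0\<close>, the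
  indicator makes the value 0, whatever \<open>f\<close> and the division return there.\<close>

definition p_dens ::
    "(real \<Rightarrow> real ^ 'n \<Rightarrow> real) \<Rightarrow> real \<Rightarrow> real ^ 'n \<Rightarrow> real ^ 'n \<Rightarrow> real" where
  "p_dens f l c x =
     l / (l + c \<bullet> x) * f (l + c \<bullet> x) x * indicator {0<..} (l + c \<bullet> x)"

text \<open>The density of each \<open>\<mu> l\<close> is determined only up to a Lebesgue-null set, whereas
  \<open>p_dens f l c x\<close> evaluates \<open>f\<close> along the hyperplane \<open>{(l + c \<bullet> x, x) | x}\<close>.
  Changing \<open>f\<close> on that hyperplane for a single \<open>l\<close> changes no \<open>\<mu> s\<close> but changes
  \<open>p_dens f l c\<close> everywhere. So the pointwise identity needs, at the point in question,
  the value of \<open>f\<close> prescribed by \<open>\<mu> l \<star> \<mu> l' = \<mu> (l + l')\<close>, where \<open>l' = c \<bullet> x\<close>:\<close>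

definition density_consistent ::
    "(real \<Rightarrow> real ^ 'n \<Rightarrow> real) \<Rightarrow> real \<Rightarrow> real \<Rightarrow> real ^ 'n \<Rightarrow> bool" where
  "density_consistent f l l' x \<longleftrightarrow>
     ennreal (f (l + l') x) = (\<integral>\<^sup>+ y. ennreal (f l y) * ennreal (f l' (x - y)) \<partial>lborel)"

end

theory Submission
  imports Defs
begin

text \<open>Write \<open>h\<close> for the convolution of \<open>f a\<close> and \<open>f b\<close>, which has a value at every point, and
  \<open>k\<close> for that of \<open>(c \<bullet> y) f a y\<close> and \<open>f b\<close>. With \<open>a = l\<close> and \<open>b = c \<bullet> x\<close> the theorem says
  that \<open>k = a / (a + b) * (c \<bullet> x) * h\<close> at \<open>x\<close>. Since multiplication by \<open>y \<mapsto> c \<bullet> y\<close> is a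
  derivation of the convolution, \<open>k\<close> is additive in \<open>a\<close> for fixed \<open>a + b\<close>; tested against
  indicators, Cauchy's equation for measurable functions gives the formula for almost every \<open>x\<close>,
  for each fixed \<open>a\<close> and \<open>b\<close>. That does not suffice, because \<open>b\<close> depends on \<open>x\<close>. But splitting
  a time interval further expresses \<open>k\<close> at a point \<open>x\<close> as an integral of the almost-everywhere
  formula at the points \<open>x - u\<close>, which upgrades the formula to every \<open>x\<close> at which the integrals
  converge. Convergence at \<open>x\<close> depends only on \<open>a + b\<close>, so it holds for almost every pair
  \<open>(a + b, x)\<close>, hence, by a shear, for almost every \<open>(l, x)\<close>.\<close>

section \<open>Translations and reflections of Lebesgue measure\<close>

lemma distr_lborel_reflect:
  fixes a :: "'a::euclidean_space"
  shows "distr lborel borel (\<lambda>x. a - x) = lborel"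
  by (subst (2) lborel_affine[of "-1" a]) (simp_all add: density_1)

lemma nn_integral_lborel_translate:
  fixes a :: "'a::euclidean_space"
  assumes "g \<in> borel_measurable borel"
  shows "(\<integral>\<^sup>+x. g (x + a) \<partial>lborel) = (\<integral>\<^sup>+x. g x \<partial>lborel)"
  using assms
  by (subst (2) lborel_distr_plus[of a, symmetric]) (simp add: nn_integral_distr add.commute)

lemma
  fixes a :: "'a::euclidean_space" and g :: "'a \<Rightarrow> real"
  assumes [measurable]: "g \<in> borel_measurable borel"
  shows integral_lborel_translate: "(\<integral>x. g (x + a) \<partial>lborel) = (\<integral>x. g x \<partial>lborel)" (is ?I)
    and integrable_lborel_translate: "integrable lborel (\<lambda>x. g (x + a)) \<longleftrightarrow> integrable lborel g" (is ?J)
proof -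
  have "integral\<^sup>L (distr lborel borel ((+) a)) g = (\<integral>x. g (x + a) \<partial>lborel)"
    by (subst integral_distr) (simp_all add: add.commute)
  then show ?I
    unfolding lborel_distr_plus by simp
  have "integrable (distr lborel borel ((+) a)) g \<longleftrightarrow> integrable lborel (\<lambda>x. g (x + a))"
    by (subst integrable_distr_eq) (simp_all add: add.commute)
  then show ?J
    unfolding lborel_distr_plus by simp
qed

lemma
  fixes a :: "'a::euclidean_space" and g :: "'a \<Rightarrow> real"
  assumes [measurable]: "g \<in> borel_measurable borel"
  shows integral_lborel_reflect: "(\<integral>x. g (a - x) \<partial>lborel) = (\<integral>x. g x \<partial>lborel)" (is ?I)
    and integrable_lborel_reflect: "integrable lborel (\<lambda>x. g (a - x)) \<longleftrightarrow> integrable lborel g" (is ?J)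
proof -
  have "integral\<^sup>L (distr lborel borel (\<lambda>x. a - x)) g = (\<integral>x. g (a - x) \<partial>lborel)"
    by (subst integral_distr) simp_all
  then show ?I
    unfolding distr_lborel_reflect by simp
  have "integrable (distr lborel borel (\<lambda>x. a - x)) g \<longleftrightarrow> integrable lborel (\<lambda>x. g (a - x))"
    by (subst integrable_distr_eq) simp_all
  then show ?J
    unfolding distr_lborel_reflect by simp
qed

lemma AE_lborel_translate:
  fixes a :: "'a::euclidean_space"
  assumes "AE x in lborel. P x"
  shows "AE x in lborel. P (x + a)"
  using AE_distrD[of "(+) a" lborel borel P, unfolded lborel_distr_plus] assms by (simp add: add.commute)

lemma AE_lborel_reflect:
  fixes a :: "'a::euclidean_space"
  assumes "AE x in lborel. P x"
  shows "AE x in lborel. P (a - x)"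
  using AE_distrD[of "\<lambda>x. a - x" lborel borel P, unfolded distr_lborel_reflect] assms by simp

section \<open>Cauchy's functional equation on an interval\<close>

text \<open>A sublevel set of \<open>\<bar>\<psi>\<bar>\<close> of nearly full measure meets each of its small
  translates, so \<open>\<psi>\<close> is bounded near \<open>0\<close>.\<close>

lemma measurable_additive_bounded_near_0:
  fixes \<psi> :: "real \<Rightarrow> real"
  assumes [measurable]: "\<psi> \<in> borel_measurable borel" and "0 < T"
    and add: "\<And>a b. 0 < a \<Longrightarrow> 0 < b \<Longrightarrow> a + b < T \<Longrightarrow> \<psi> (a + b) = \<psi> a + \<psi> b"
  obtains B where "\<And>s. 0 < s \<Longrightarrow> s < T / 4 \<Longrightarrow> \<bar>\<psi> s\<bar> \<le> B"
proof -
  define E where "E n = {x \<in> {0<..<T}. \<bar>\<psi> x\<bar> \<le> real n}" for n :: nat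
  have [measurable]: "E n \<in> sets borel" for n
    unfolding E_def by measurable
  have inc: "incseq E"
    by (auto simp: E_def incseq_def)
  have un: "(\<Union>n. E n) = {0<..<T}"
    using real_arch_simple by (auto simp: E_def)
  have sub: "E n \<subseteq> {0<..<T}" for n
    by (auto simp: E_def)
  have ival: "{0<..<u} \<in> fmeasurable lborel" if "0 < u" for u :: real
    using that by (intro fmeasurableI) simp_all
  have fin: "E n \<in> fmeasurable lborel" for n
    by (rule fmeasurableI2[OF ival[OF \<open>0 < T\<close>] sub]) simp
  have "(\<lambda>n. measure lborel (E n)) \<longlonglongrightarrow> measure lborel (\<Union>n. E n)"
    using \<open>0 < T\<close> by (intro Lim_measure_incseq inc) (auto simp: un)
  then have "(\<lambda>n. measure lborel (E n)) \<longlonglongrightarrow> T"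
    using \<open>0 < T\<close> by (simp add: un)
  \<comment> \<open>Two disjoint copies of such a set would have total measure above
    \<open>3 / 2 * T\<close>, but both lie in \<open>{0<..<T + s}\<close>, of length below
    \<open>5 / 4 * T\<close>.\<close>
  then have "\<forall>\<^sub>F n in sequentially. 3 / 4 * T < measure lborel (E n)"
    using \<open>0 < T\<close> by (intro order_tendstoD) auto
  then obtain n where n: "3 / 4 * T < measure lborel (E n)"
    by (auto simp: eventually_sequentially)
  have "\<bar>\<psi> s\<bar> \<le> 2 * real n" if s: "0 < s" "s < T / 4" for s
  proof -
    have vim: "(+) s ` E n = (+) (- s) -` E n"
      by (force simp: image_iff)
    have [measurable]: "(+) s ` E n \<in> sets borel"
      unfolding vim by (rule measurable_sets_borel[OF _ \<open>E n \<in> sets borel\<close>]) simp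
    have "emeasure lborel (E n) = emeasure (distr lborel borel ((+) (- s))) (E n)"
      by (simp only: lborel_distr_plus)
    also have "\<dots> = emeasure lborel ((+) s ` E n)"
      by (subst emeasure_distr) (simp_all add: vim)
    finally have meas: "measure lborel ((+) s ` E n) = measure lborel (E n)"
      by (simp add: measure_def)
    have "E n \<inter> (+) s ` E n \<noteq> {}"
    proof
      assume disj: "E n \<inter> (+) s ` E n = {}"
      have "(+) s ` E n \<in> fmeasurable lborel"
        using s sub[of n] \<open>0 < T\<close> by (intro fmeasurableI2[OF ival[of "T + s"]]) auto
      then have "2 * measure lborel (E n) = measure lborel (E n \<union> (+) s ` E n)"
        using measure_Un3[OF fin[of n], of "(+) s ` E n"] disj meas by simp
      also have "\<dots> \<le> measure lborel {0<..<T + s}"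
        using s sub[of n] \<open>0 < T\<close> by (intro measure_mono_fmeasurable ival) auto
      also have "\<dots> = T + s"
        using s \<open>0 < T\<close> by simp
      finally show False
        using n s by simp
    qed
    then obtain a where "a \<in> E n" "s + a \<in> E n"
      by blast
    with s add[of s a] show ?thesis
      by (auto simp: E_def)
  qed
  then show ?thesis
    by (rule that)
qed

text \<open>Subtracting a linear function gives an additive \<open>g\<close> with
  \<open>g b = 0\<close>, so \<open>g\<close> vanishes at \<open>u = b / m\<close> and at its
  multiples. Hence \<open>g a = g r\<close> for the remainder \<open>r\<close> of \<open>a\<close>
  modulo \<open>u\<close>. As \<open>Suc N * r\<close> stays where
  \<open>\<bar>g\<bar> \<le> B\<close>, this value is at most \<open>B / Suc N\<close>.\<close>

lemma measurable_additive_linear: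
  fixes \<psi> :: "real \<Rightarrow> real"
  assumes meas [measurable]: "\<psi> \<in> borel_measurable borel"
    and add: "\<And>a b. 0 < a \<Longrightarrow> 0 < b \<Longrightarrow> a + b < T \<Longrightarrow> \<psi> (a + b) = \<psi> a + \<psi> b"
    and a: "0 < a" "a < T" and b: "0 < b" "b < T"
  shows "\<psi> a * b = \<psi> b * a"
proof -
  define g where "g x = \<psi> x - x * (\<psi> b / b)" for x
  have g_add: "g (x + y) = g x + g y" if "0 < x" "0 < y" "x + y < T" for x y
    using add[OF that] by (simp add: g_def distrib_right add_divide_distrib)
  have [measurable]: "g \<in> borel_measurable borel"
    unfolding g_def by measurable
  obtain B where B: "\<bar>g s\<bar> \<le> B" if "0 < s" "s < T / 4" for s
    using measurable_additive_bounded_near_0[of g T] g_add a by auto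
  have g_mult: "g (real (Suc k) * x) = real (Suc k) * g x" if "0 < x" "real (Suc k) * x < T" for k x
    using that
  proof (induction k)
    case (Suc k)
    have "g (real (Suc k) * x + x) = g (real (Suc k) * x) + g x"
      using Suc.prems by (intro g_add mult_pos_pos) (auto simp: algebra_simps)
    moreover have "g (real (Suc k) * x) = real (Suc k) * g x"
      using Suc.prems by (intro Suc.IH) (auto simp: algebra_simps)
    ultimately show ?case
      by (simp add: algebra_simps)
  qed simp
  have "g b = 0"
    using b by (simp add: g_def)
  have "\<bar>g a\<bar> \<le> B / real (Suc N)" for N
  proof -
    \<comment> \<open>Chosen so that \<open>u = b / m\<close> is below \<open>a\<close> and
      \<open>Suc N * u\<close> is below \<open>T / 4\<close>, the range of the bound
      \<open>B\<close>.\<close>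
    obtain m :: nat where m: "4 * b * real (Suc N) / T + b / a < real m"
      using reals_Archimedean2 by blast
    have "0 < 4 * b * real (Suc N) / T" "0 < b / a"
      using a b by simp_all
    with m have "4 * b * real (Suc N) / T < real m" "b / a < real m" "0 < real m"
      by linarith+
    then have "0 < m"
      by simp
    define u where "u = b / real m"
    have "0 < u"
      using b \<open>0 < m\<close> by (simp add: u_def)
    have u: "real (Suc N) * u < T / 4" "u < a"
      using a b \<open>0 < m\<close> \<open>4 * b * real (Suc N) / T < real m\<close> \<open>b / a < real m\<close>
      by (simp_all add: u_def field_simps)
    have "real (Suc (m - 1)) * u = b"
      using \<open>0 < m\<close> by (simp add: u_def)
    with g_mult[of u "m - 1"] \<open>0 < u\<close> b \<open>g b = 0\<close> have "g u = 0"
      by simp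
    define k where "k = nat \<lfloor>a / u\<rfloor>"
    define r where "r = a - real k * u"
    have "1 \<le> a / u"
      using u \<open>0 < u\<close> by simp
    then have "1 \<le> k" "real k \<le> a / u" "a / u < real k + 1"
      unfolding k_def by linarith+
    then have r: "0 \<le> r" "r < u"
      using \<open>0 < u\<close> by (simp_all add: r_def field_simps)
    have ku: "g (real k * u) = 0"
      using g_mult[of u "k - 1"] \<open>1 \<le> k\<close> \<open>0 < u\<close> \<open>g u = 0\<close> r a by (simp add: r_def)
    show ?thesis
    \<comment> \<open>Additivity is available for positive arguments only.\<close>
    proof (cases "r = 0")
      case True
      with ku have "g a = 0"
        by (simp add: r_def)
      moreover have "0 \<le> B"
        using B[of "T / 8"] a by auto
      ultimately show ?thesis
        by simp
    next
      case False
      then have "0 < r"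
        using r by simp
      have Nr: "real (Suc N) * r < T / 4"
        using mult_left_mono[of r u "real (Suc N)"] r u(1) by linarith
      have "g a = g r"
        using g_add[of "real k * u" r] ku \<open>0 < r\<close> \<open>1 \<le> k\<close> \<open>0 < u\<close> a by (simp add: r_def)
      moreover have "g (real (Suc N) * r) = real (Suc N) * g r"
        using Nr \<open>0 < r\<close> a by (intro g_mult) auto
      moreover have "\<bar>g (real (Suc N) * r)\<bar> \<le> B"
        using Nr \<open>0 < r\<close> by (intro B) auto
      ultimately show ?thesis
        by (simp add: field_simps abs_mult)
    qed
  qed
  moreover have "(\<lambda>N. B / real (Suc N)) \<longlonglongrightarrow> 0"
    using tendsto_mult_right_zero[OF LIMSEQ_inverse_real_of_nat] by (simp add: divide_inverse)
  ultimately have "\<bar>g a\<bar> \<le> 0"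
    by (intro LIMSEQ_le_const) auto
  then show ?thesis
    using b by (simp add: g_def field_simps)
qed

section \<open>Semigroups of densities and their convolutions\<close>

text \<open>What is kept of the exponential moments is finite mass and a first moment along
  \<open>c\<close>. \<open>F\<close> is nonnegative and jointly measurable over all real times, so
  times such as \<open>T - a\<close> or \<open>c \<bullet> x\<close> need no sign condition in
  measurability arguments.\<close>

locale density_semigroup =
  fixes F :: "real \<Rightarrow> 'a::euclidean_space \<Rightarrow> real" and c :: 'a
  assumes F_nonneg [simp]: "0 \<le> F l x"
    and F_measurable: "case_prod F \<in> borel_measurable (borel \<Otimes>\<^sub>M borel)"
    and integrable_F: "0 < l \<Longrightarrow> integrable lborel (F l)"
    and integrable_moment_F: "0 < l \<Longrightarrow> integrable lborel (\<lambda>x. F l x * (c \<bullet> x))"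
    and distr_add: "0 < a \<Longrightarrow> 0 < b \<Longrightarrow>
      distr (density lborel (F a) \<Otimes>\<^sub>M density lborel (F b)) borel (\<lambda>(x, y). x + y) =
      density lborel (F (a + b))"
begin

abbreviation M :: "real \<Rightarrow> 'a measure" where
  "M l \<equiv> density lborel (\<lambda>x. ennreal (F l x))"

lemma measurable_F [measurable (raw)]:
  assumes [measurable]: "g \<in> borel_measurable N" "h \<in> borel_measurable N"
  shows "(\<lambda>x. F (g x) (h x)) \<in> borel_measurable N"
  using measurable_compose[OF measurable_Pair[OF assms] F_measurable] by simp

lemma integrable_M:
  fixes g :: "'a \<Rightarrow> real"
  assumes [measurable]: "g \<in> borel_measurable borel"
  shows "integrable (M l) g \<longleftrightarrow> integrable lborel (\<lambda>x. F l x * g x)"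
  by (subst integrable_density) auto

lemma integral_M:
  fixes g :: "'a \<Rightarrow> real"
  assumes [measurable]: "g \<in> borel_measurable borel"
  shows "integral\<^sup>L (M l) g = (\<integral>x. F l x * g x \<partial>lborel)"
  by (subst integral_density) auto

lemma nn_integral_M:
  assumes [measurable]: "g \<in> borel_measurable borel"
  shows "integral\<^sup>N (M l) g = (\<integral>\<^sup>+x. ennreal (F l x) * g x \<partial>lborel)"
  by (subst nn_integral_density) auto

lemma finite_measure_M:
  assumes "0 < l"
  shows "finite_measure (M l)"
proof (rule finite_measureI)
  have "emeasure (M l) (space (M l)) = (\<integral>\<^sup>+x. ennreal (F l x) \<partial>lborel)"
    by (simp add: emeasure_density)
  also have "\<dots> = ennreal (\<integral>x. F l x \<partial>lborel)"
    using integrable_F[OF assms] by (intro nn_integral_eq_integral) auto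
  finally show "emeasure (M l) (space (M l)) \<noteq> \<infinity>"
    by simp
qed

lemma pair_sigma_finite_M:
  assumes "0 < a" "0 < b"
  shows "pair_sigma_finite (M a) (M b)"
  using finite_measure_M assms
  by (simp add: pair_sigma_finite_def finite_measure_def)

lemma integrable_moment:
  assumes "0 < l"
  shows "integrable (M l) (\<lambda>x. c \<bullet> x)"
  using integrable_moment_F[OF assms] by (simp add: integrable_M)

lemma nn_integral_M_add:
  assumes "0 < a" "0 < b" and [measurable]: "g \<in> borel_measurable borel"
  shows "(\<integral>\<^sup>+x. g x \<partial>M (a + b)) = (\<integral>\<^sup>+u. \<integral>\<^sup>+v. g (u + v) \<partial>M b \<partial>M a)"
proof -
  interpret pair_sigma_finite "M a" "M b"
    using assms by (intro pair_sigma_finite_M)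
  show ?thesis
    using assms(1,2)
    by (simp add: distr_add[symmetric] nn_integral_distr M2.nn_integral_fst[symmetric])
qed

lemma
  fixes g :: "'a \<Rightarrow> real"
  assumes ab: "0 < a" "0 < b" and g: "integrable (M (a + b)) g"
  shows integrable_M_add: "integrable (M a \<Otimes>\<^sub>M M b) (\<lambda>(u, v). g (u + v))"
    and integral_M_add: "(\<integral>x. g x \<partial>M (a + b)) = (\<integral>u. \<integral>v. g (u + v) \<partial>M b \<partial>M a)"
proof -
  interpret pair_sigma_finite "M a" "M b"
    using ab by (intro pair_sigma_finite_M)
  have [measurable]: "g \<in> borel_measurable borel"
    using borel_measurable_integrable[OF g] by simp
  show int: "integrable (M a \<Otimes>\<^sub>M M b) (\<lambda>(u, v). g (u + v))"
    using g unfolding distr_add[OF ab, symmetric]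
    by (subst (asm) integrable_distr_eq) (auto simp: case_prod_beta')
  show "(\<integral>x. g x \<partial>M (a + b)) = (\<integral>u. \<integral>v. g (u + v) \<partial>M b \<partial>M a)"
    unfolding distr_add[OF ab, symmetric] integral_fst[OF int]
    by (subst integral_distr) (auto simp: case_prod_beta')
qed

text \<open>By Tonelli and a translation, both sides are Lebesgue densities of the same measure
  \<open>M (a + b)\<close>; such densities agree almost everywhere.\<close>

lemma AE_nn_integral_conv:
  assumes "0 < a" "0 < b"
  shows "AE w in lborel. (\<integral>\<^sup>+v. ennreal (F b (w - v)) \<partial>M a) = ennreal (F (a + b) w)"
proof (rule sigma_finite_measure.density_unique[OF lborel.sigma_finite_measure_axioms])
  interpret A: finite_measure "M a"
    using assms by (intro finite_measure_M)
  interpret pair_sigma_finite "M a" "lborel :: 'a measure" ..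
  show [measurable]: "(\<lambda>w. \<integral>\<^sup>+v. ennreal (F b (w - v)) \<partial>M a) \<in> borel_measurable lborel"
    by measurable
  show "(\<lambda>w. ennreal (F (a + b) w)) \<in> borel_measurable lborel"
    by measurable
  show "density lborel (\<lambda>w. \<integral>\<^sup>+v. ennreal (F b (w - v)) \<partial>M a) = M (a + b)"
  proof (rule measure_eqI)
    fix A assume "A \<in> sets (density lborel (\<lambda>w. \<integral>\<^sup>+v. ennreal (F b (w - v)) \<partial>M a))"
    then have [measurable]: "A \<in> sets borel"
      by simp
    have "emeasure (density lborel (\<lambda>w. \<integral>\<^sup>+v. ennreal (F b (w - v)) \<partial>M a)) A =
        (\<integral>\<^sup>+w. \<integral>\<^sup>+v. ennreal (F b (w - v)) * indicator A w \<partial>M a \<partial>lborel)"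
      by (simp add: emeasure_density nn_integral_multc)
    also have "\<dots> = (\<integral>\<^sup>+v. \<integral>\<^sup>+w. ennreal (F b (w - v)) * indicator A w \<partial>lborel \<partial>M a)"
      by (rule Fubini') simp
    also have "\<dots> = (\<integral>\<^sup>+v. \<integral>\<^sup>+w. indicator A (v + w) \<partial>M b \<partial>M a)"
    proof (rule nn_integral_cong)
      fix v
      have "(\<integral>\<^sup>+w. ennreal (F b (w - v)) * indicator A w \<partial>lborel) =
          (\<integral>\<^sup>+w. ennreal (F b (w + v - v)) * indicator A (w + v) \<partial>lborel)"
        by (subst nn_integral_lborel_translate) auto
      also have "\<dots> = (\<integral>\<^sup>+w. indicator A (v + w) \<partial>M b)"
        by (subst nn_integral_M) (auto simp: add.commute)
      finally show "(\<integral>\<^sup>+w. ennreal (F b (w - v)) * indicator A w \<partial>lborel) =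
          (\<integral>\<^sup>+w. indicator A (v + w) \<partial>M b)" .
    qed
    also have "\<dots> = (\<integral>\<^sup>+w. indicator A w \<partial>M (a + b))"
      using assms by (subst nn_integral_M_add) auto
    also have "\<dots> = emeasure (M (a + b)) A"
      by simp
    finally show "emeasure (density lborel (\<lambda>w. \<integral>\<^sup>+v. ennreal (F b (w - v)) \<partial>M a)) A =
        emeasure (M (a + b)) A" .
  qed simp
qed

text \<open>Unlike the densities, their convolution has a value at every point; the value at \<open>x\<close>
  depends only on the sum of the two parameters.\<close>

lemma nn_integral_conv_assoc:
  assumes "0 < a" "0 < b" "0 < d"
  shows "(\<integral>\<^sup>+y. ennreal (F d (x - y)) \<partial>M (a + b)) = (\<integral>\<^sup>+y. ennreal (F (b + d) (x - y)) \<partial>M a)"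
proof -
  have "(\<integral>\<^sup>+y. ennreal (F d (x - y)) \<partial>M (a + b)) =
      (\<integral>\<^sup>+u. \<integral>\<^sup>+v. ennreal (F d (x - (u + v))) \<partial>M b \<partial>M a)"
    using assms by (subst nn_integral_M_add) auto
  also have "\<dots> = (\<integral>\<^sup>+u. ennreal (F (b + d) (x - u)) \<partial>M a)"
  proof (rule nn_integral_cong_AE)
    \<comment> \<open>For every fixed \<open>x\<close>, the exceptional points \<open>x - u\<close>
      correspond to a null set of \<open>u\<close>, which the integral over \<open>u\<close>
      ignores.\<close>
    have "AE u in lborel. (\<integral>\<^sup>+v. ennreal (F d (x - u - v)) \<partial>M b) = ennreal (F (b + d) (x - u))"
      using assms by (intro AE_lborel_reflect AE_nn_integral_conv)
    then show "AE u in M a. (\<integral>\<^sup>+v. ennreal (F d (x - (u + v))) \<partial>M b) = ennreal (F (b + d) (x - u))"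
      by (subst AE_density) (auto simp: diff_diff_eq elim: eventually_mono)
  qed
  finally show ?thesis .
qed

section \<open>First moments of convolutions, tested against bounded functions\<close>

lemma
  assumes ab: "0 < a" "0 < b"
  shows integrable_moment_fst: "integrable (M a \<Otimes>\<^sub>M M b) (\<lambda>(u, v). c \<bullet> u)"
    and integrable_moment_snd: "integrable (M a \<Otimes>\<^sub>M M b) (\<lambda>(u, v). c \<bullet> v)"
proof -
  interpret A: finite_measure "M a"
    using ab by (intro finite_measure_M)
  interpret B: finite_measure "M b"
    using ab by (intro finite_measure_M)
  interpret pair_sigma_finite "M a" "M b" ..
  show "integrable (M a \<Otimes>\<^sub>M M b) (\<lambda>(u, v). c \<bullet> u)"
    using integrable_moment[OF ab(1)] by (intro Fubini_integrable) auto
  show "integrable (M a \<Otimes>\<^sub>M M b) (\<lambda>(u, v). c \<bullet> v)"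
    using integrable_moment[OF ab(2)] by (intro Fubini_integrable) auto
qed

text \<open>Under the product measure, \<open>c \<bullet> (u + v)\<close> splits into
  \<open>c \<bullet> u\<close> and \<open>c \<bullet> v\<close>. Boundedness of \<open>g\<close>
  makes each term integrable, so Fubini applies to each separately.\<close>

lemma moment_derivation:
  fixes g :: "'a \<Rightarrow> real"
  assumes ab: "0 < a" "0 < b" and [measurable]: "g \<in> borel_measurable borel"
    and bound: "\<And>x. \<bar>g x\<bar> \<le> B"
  shows "(\<integral>x. (c \<bullet> x) * g x \<partial>M (a + b)) =
    (\<integral>u. (c \<bullet> u) * (\<integral>v. g (u + v) \<partial>M b) \<partial>M a) + (\<integral>v. (c \<bullet> v) * (\<integral>u. g (v + u) \<partial>M a) \<partial>M b)"
proof -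
  interpret pair_sigma_finite "M a" "M b"
    using ab by (intro pair_sigma_finite_M)
  have "0 \<le> B"
    using bound[of 0] by simp
  have dom: "\<bar>r * g x\<bar> \<le> \<bar>B * r\<bar>" for r x
    using bound[of x] \<open>0 \<le> B\<close> by (simp add: abs_mult mult.commute[of B] mult_left_mono)
  have int: "integrable (M (a + b)) (\<lambda>x. (c \<bullet> x) * g x)"
  proof (rule Bochner_Integration.integrable_bound)
    show "integrable (M (a + b)) (\<lambda>x. B * (c \<bullet> x))"
      using ab by (intro integrable_mult_right integrable_moment) simp
  qed (simp_all add: dom)
  have fst: "integrable (M a \<Otimes>\<^sub>M M b) (\<lambda>(u, v). (c \<bullet> u) * g (u + v))"
  proof (rule Bochner_Integration.integrable_bound)
    show "integrable (M a \<Otimes>\<^sub>M M b) (\<lambda>p. B * (case p of (u, v) \<Rightarrow> c \<bullet> u))"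
      by (intro integrable_mult_right integrable_moment_fst ab)
  qed (simp_all add: dom case_prod_beta)
  have snd: "integrable (M a \<Otimes>\<^sub>M M b) (\<lambda>(u, v). (c \<bullet> v) * g (u + v))"
  proof (rule Bochner_Integration.integrable_bound)
    show "integrable (M a \<Otimes>\<^sub>M M b) (\<lambda>p. B * (case p of (u, v) \<Rightarrow> c \<bullet> v))"
      by (intro integrable_mult_right integrable_moment_snd ab)
  qed (simp_all add: dom case_prod_beta)
  have "(\<integral>x. (c \<bullet> x) * g x \<partial>M (a + b)) =
      (\<integral>u. \<integral>v. (c \<bullet> (u + v)) * g (u + v) \<partial>M b \<partial>M a)"
    by (rule integral_M_add[OF ab int])
  also have "\<dots> = (\<integral>p. (case p of (u, v) \<Rightarrow> (c \<bullet> (u + v)) * g (u + v)) \<partial>(M a \<Otimes>\<^sub>M M b))"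
    by (rule integral_fst[OF integrable_M_add[OF ab int]])
  also have "\<dots> = (\<integral>p. (case p of (u, v) \<Rightarrow> (c \<bullet> u) * g (u + v)) + (case p of (u, v) \<Rightarrow> (c \<bullet> v) * g (u + v)) \<partial>(M a \<Otimes>\<^sub>M M b))"
    by (intro Bochner_Integration.integral_cong) (auto simp: algebra_simps)
  also have "\<dots> = (\<integral>p. (case p of (u, v) \<Rightarrow> (c \<bullet> u) * g (u + v)) \<partial>(M a \<Otimes>\<^sub>M M b)) +
      (\<integral>p. (case p of (u, v) \<Rightarrow> (c \<bullet> v) * g (u + v)) \<partial>(M a \<Otimes>\<^sub>M M b))"
    by (rule Bochner_Integration.integral_add[OF fst snd])
  also have "(\<integral>p. (case p of (u, v) \<Rightarrow> (c \<bullet> u) * g (u + v)) \<partial>(M a \<Otimes>\<^sub>M M b)) =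
      (\<integral>u. (c \<bullet> u) * (\<integral>v. g (u + v) \<partial>M b) \<partial>M a)"
    unfolding integral_fst[OF fst, symmetric] by (simp only: integral_mult_right_zero)
  also have "(\<integral>p. (case p of (u, v) \<Rightarrow> (c \<bullet> v) * g (u + v)) \<partial>(M a \<Otimes>\<^sub>M M b)) =
      (\<integral>v. (c \<bullet> v) * (\<integral>u. g (v + u) \<partial>M a) \<partial>M b)"
    unfolding integral_snd[OF snd, symmetric] by (simp only: integral_mult_right_zero add.commute)
  finally show ?thesis .
qed

text \<open>For bounded measurable \<open>g\<close>, this is the integral of \<open>g\<close>
  against the convolution of \<open>(c \<bullet> y) * F a y\<close> and \<open>F b\<close>. As a
  number for each pair of times, it can be studied as a function of time without null sets that vary
  with the time.\<close>

definition moment_pairing :: "('a \<Rightarrow> real) \<Rightarrow> real \<Rightarrow> real \<Rightarrow> real" where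
  "moment_pairing g a b = (\<integral>u. (c \<bullet> u) * (\<integral>v. g (u + v) \<partial>M b) \<partial>M a)"

lemma integral_translate_bounded:
  fixes g :: "'a \<Rightarrow> real"
  assumes "0 < d" and [measurable]: "g \<in> borel_measurable borel" and bound: "\<And>x. \<bar>g x\<bar> \<le> B"
  shows "integrable (M d) (\<lambda>v. g (u + v))"
    and "\<bar>\<integral>v. g (u + v) \<partial>M d\<bar> \<le> (\<integral>v. B \<partial>M d)"
proof -
  interpret finite_measure "M d"
    using assms by (intro finite_measure_M)
  show int: "integrable (M d) (\<lambda>v. g (u + v))"
    using bound by (intro integrable_const_bound[of _ B]) simp_all
  have "\<bar>\<integral>v. g (u + v) \<partial>M d\<bar> \<le> (\<integral>v. \<bar>g (u + v)\<bar> \<partial>M d)"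
    by (rule integral_abs_bound)
  also have "\<dots> \<le> (\<integral>v. B \<partial>M d)"
    using int bound by (intro integral_mono) simp_all
  finally show "\<bar>\<integral>v. g (u + v) \<partial>M d\<bar> \<le> (\<integral>v. B \<partial>M d)" .
qed

text \<open>This is \<open>moment_derivation\<close> for \<open>h\<close>, the integral of the
  translates of \<open>g\<close> over \<open>M d\<close>; integrating \<open>h\<close> over
  \<open>M b\<close> or \<open>M a\<close> merges the times into \<open>b + d\<close> or
  \<open>a + d\<close>. All three terms have total time \<open>a + b + d\<close>, so this is
  Cauchy's equation in the first time.\<close>

lemma moment_pairing_add:
  fixes g :: "'a \<Rightarrow> real"
  assumes "0 < a" "0 < b" "0 < d"
    and [measurable]: "g \<in> borel_measurable borel" and bound: "\<And>x. \<bar>g x\<bar> \<le> B"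
  shows "moment_pairing g (a + b) d = moment_pairing g a (b + d) + moment_pairing g b (a + d)"
proof -
  define h where "h x = (\<integral>z. g (x + z) \<partial>M d)" for x
  interpret D: finite_measure "M d"
    using assms by (intro finite_measure_M)
  have [measurable]: "h \<in> borel_measurable borel"
    unfolding h_def by measurable
  have *: "(\<integral>v. h (u + v) \<partial>M s) = (\<integral>v. g (u + v) \<partial>M (s + d))" if "0 < s" for s u
  proof -
    have "integrable (M (s + d)) (\<lambda>v. g (u + v))"
      using that \<open>0 < d\<close> bound by (intro integral_translate_bounded(1)) auto
    from integral_M_add[OF that \<open>0 < d\<close> this] show ?thesis
      by (simp add: h_def add.assoc)
  qed
  have h_bound: "\<bar>h x\<bar> \<le> (\<integral>v. B \<partial>M d)" for x
    unfolding h_def by (rule integral_translate_bounded(2)[OF \<open>0 < d\<close> _ bound]) simp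
  have "moment_pairing g (a + b) d = (\<integral>x. (c \<bullet> x) * h x \<partial>M (a + b))"
    by (simp add: moment_pairing_def h_def)
  also have "\<dots> = (\<integral>u. (c \<bullet> u) * (\<integral>v. h (u + v) \<partial>M b) \<partial>M a) +
      (\<integral>v. (c \<bullet> v) * (\<integral>u. h (v + u) \<partial>M a) \<partial>M b)"
    by (rule moment_derivation[OF assms(1,2) _ h_bound]) simp
  also have "\<dots> = moment_pairing g a (b + d) + moment_pairing g b (a + d)"
    using assms by (simp only: * moment_pairing_def)
  finally show ?thesis .
qed

text \<open>The measure \<open>M a\<close> itself varies with \<open>a\<close>, so the pairing is
  rewritten with Lebesgue integrals of jointly measurable functions.\<close>

lemma measurable_moment_pairing:
  fixes g :: "'a \<Rightarrow> real"
  assumes [measurable]: "g \<in> borel_measurable borel"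
  shows "(\<lambda>a. moment_pairing g a (T - a)) \<in> borel_measurable borel"
proof -
  have eq: "moment_pairing g a b = (\<integral>u. F a u * ((c \<bullet> u) * (\<integral>v. F b v * g (u + v) \<partial>lborel)) \<partial>lborel)" for a b
    unfolding moment_pairing_def by (simp add: integral_M)
  show ?thesis
    unfolding eq by measurable
qed

text \<open>At fixed total time the pairing is additive and measurable in its first time, hence
  proportional to it. The factor comes from \<open>\<psi> a + \<psi> b\<close>, which
  \<open>moment_derivation\<close> identifies with the full moment at time
  \<open>a + b\<close>.\<close>

lemma moment_pairing_eq:
  fixes g :: "'a \<Rightarrow> real"
  assumes ab: "0 < a" "0 < b"
    and [measurable]: "g \<in> borel_measurable borel" and bound: "\<And>x. \<bar>g x\<bar> \<le> B"
  shows "moment_pairing g a b = a / (a + b) * (\<integral>x. (c \<bullet> x) * g x \<partial>M (a + b))"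
proof -
  define \<psi> where "\<psi> s = moment_pairing g s (a + b - s)" for s
  have "\<psi> a * b = \<psi> b * a"
  proof (rule measurable_additive_linear[where T = "a + b"])
    show "\<psi> \<in> borel_measurable borel"
      unfolding \<psi>_def by (rule measurable_moment_pairing) simp
    show "\<psi> (s + t) = \<psi> s + \<psi> t" if "0 < s" "0 < t" "s + t < a + b" for s t
      using moment_pairing_add[of s t "a + b - (s + t)" g B] that bound by (simp add: \<psi>_def algebra_simps)
  qed (use ab in auto)
  moreover have X: "(\<integral>x. (c \<bullet> x) * g x \<partial>M (a + b)) = \<psi> a + \<psi> b"
    using moment_derivation[OF ab _ bound] by (simp add: \<psi>_def moment_pairing_def)
  ultimately have "\<psi> a * (a + b) = a * (\<psi> a + \<psi> b)"
    by (simp add: algebra_simps)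
  then have "\<psi> a = a / (a + b) * (\<psi> a + \<psi> b)"
    using ab by (simp add: eq_divide_eq)
  then show ?thesis
    unfolding X by (simp add: \<psi>_def)
qed

text \<open>Both sides are integrable in \<open>w\<close> and have the same integral over every
  Borel set \<open>A\<close>: Fubini turns that of the left side into
  \<open>moment_pairing (indicator A) a b\<close>.\<close>

lemma AE_moment_conv:
  assumes ab: "0 < a" "0 < b"
  shows "AE w in lborel. integrable (M a) (\<lambda>v. (c \<bullet> v) * F b (w - v)) \<and>
    (\<integral>v. (c \<bullet> v) * F b (w - v) \<partial>M a) = a / (a + b) * (c \<bullet> w) * F (a + b) w"
proof -
  interpret A: finite_measure "M a"
    using ab by (intro finite_measure_M)
  interpret pair_sigma_finite "M a" "lborel :: 'a measure" ..
  have trans: "(\<integral>w. h w * F b (w - v) \<partial>lborel) = (\<integral>w. F b w * h (v + w) \<partial>lborel)"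
    if [measurable]: "h \<in> borel_measurable borel" for h :: "'a \<Rightarrow> real" and v
    using integral_lborel_translate[of "\<lambda>w. h w * F b (w - v)" v] by (simp add: ac_simps)
  have int: "integrable (M a \<Otimes>\<^sub>M lborel) (\<lambda>(v, w). (c \<bullet> v) * F b (w - v))"
  proof (rule Fubini_integrable)
    have "integrable (M a) (\<lambda>v. \<bar>c \<bullet> v\<bar> * (\<integral>w. F b w \<partial>lborel))"
      using integrable_moment[OF ab(1)] by simp
    then show "integrable (M a) (\<lambda>v. \<integral>w. norm (case (v, w) of (v, w) \<Rightarrow> (c \<bullet> v) * F b (w - v)) \<partial>lborel)"
      using trans[of "\<lambda>_. 1"] by (simp add: abs_mult)
    show "AE v in M a. integrable lborel (\<lambda>w. case (v, w) of (v, w) \<Rightarrow> (c \<bullet> v) * F b (w - v))"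
    proof (rule AE_I2)
      fix v
      show "integrable lborel (\<lambda>w. case (v, w) of (v, w) \<Rightarrow> (c \<bullet> v) * F b (w - v))"
        using integrable_lborel_translate[of "F b" "- v"] integrable_F[OF ab(2)] by simp
    qed
  qed simp
  have R: "integrable lborel (\<lambda>w. a / (a + b) * (c \<bullet> w) * F (a + b) w)"
    using integrable_moment_F[of "a + b"] ab by (simp add: ac_simps)
  have "AE w in lborel. (\<integral>v. (c \<bullet> v) * F b (w - v) \<partial>M a) = a / (a + b) * (c \<bullet> w) * F (a + b) w"
  proof (rule density_unique_real[OF integrable_snd[OF int] R])
    fix A :: "'a set" assume "A \<in> sets lborel"
    then have [measurable]: "A \<in> sets borel"
      by simp
    have intA: "integrable (M a \<Otimes>\<^sub>M lborel) (\<lambda>(v, w). indicator A w * ((c \<bullet> v) * F b (w - v)))"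
      by (rule Bochner_Integration.integrable_bound[OF int])
        (auto simp: indicator_def case_prod_beta)
    have "(\<integral>w\<in>A. (\<integral>v. (c \<bullet> v) * F b (w - v) \<partial>M a) \<partial>lborel) =
        (\<integral>w. \<integral>v. indicator A w * ((c \<bullet> v) * F b (w - v)) \<partial>M a \<partial>lborel)"
      by (simp add: set_lebesgue_integral_def)
    also have "\<dots> = (\<integral>v. \<integral>w. indicator A w * ((c \<bullet> v) * F b (w - v)) \<partial>lborel \<partial>M a)"
      by (rule Fubini_integral[OF intA])
    also have "\<dots> = moment_pairing (indicator A) a b"
      unfolding moment_pairing_def using trans[of "indicator A"]
      by (simp add: integral_M mult.left_commute[of "indicator A _"])
    also have "\<dots> = a / (a + b) * (\<integral>x. (c \<bullet> x) * indicator A x \<partial>M (a + b))"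
      by (rule moment_pairing_eq[OF ab, of _ 1]) (auto simp: indicator_def)
    also have "\<dots> = (\<integral>w. a / (a + b) * (F (a + b) w * ((c \<bullet> w) * indicator A w)) \<partial>lborel)"
      by (subst integral_M) simp_all
    also have "\<dots> = (\<integral>w\<in>A. a / (a + b) * (c \<bullet> w) * F (a + b) w \<partial>lborel)"
      unfolding set_lebesgue_integral_def
      by (intro Bochner_Integration.integral_cong refl) (simp add: mult_ac)
    finally show "(\<integral>w\<in>A. (\<integral>v. (c \<bullet> v) * F b (w - v) \<partial>M a) \<partial>lborel) =
        (\<integral>w\<in>A. a / (a + b) * (c \<bullet> w) * F (a + b) w \<partial>lborel)" .
  qed
  with AE_integrable_snd[OF int] show ?thesis
    by eventually_elim simp
qed

lemma AE_conv:
  assumes ab: "0 < a" "0 < b"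
  shows "AE w in lborel. integrable (M a) (\<lambda>v. F b (w - v)) \<and> (\<integral>v. F b (w - v) \<partial>M a) = F (a + b) w"
  using AE_nn_integral_conv[OF ab]
proof eventually_elim
  case (elim w)
  then have "has_bochner_integral (M a) (\<lambda>v. F b (w - v)) (F (a + b) w)"
    by (intro has_bochner_integral_nn_integral) simp_all
  then show ?case
    by (simp add: has_bochner_integral_iff)
qed

section \<open>Bridge moments at every point\<close>

text \<open>View \<open>F a\<close>, \<open>F b\<close>, \<open>F d\<close> as laws of independent increments \<open>u\<close>, \<open>v\<close>, \<open>w\<close>. Given
  \<open>u + v + w = x\<close>, the conditional mean of \<open>c \<bullet> (u + v)\<close> given \<open>u\<close> is
  \<open>c \<bullet> u + b / (b + d) * (c \<bullet> (x - u))\<close> for almost every \<open>u\<close>; integrating over \<open>u\<close> leads to an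
  identity at every single \<open>x\<close>.\<close>

lemma
  assumes pos: "0 < a" "0 < b" "0 < d"
    and mass: "integrable (M a) (\<lambda>u. F (b + d) (x - u))"
    and moment: "integrable (M (a + b)) (\<lambda>y. (c \<bullet> y) * F d (x - y))"
  shows bridge_moment_mono: "integrable (M a) (\<lambda>u. (c \<bullet> u) * F (b + d) (x - u))"
    and bridge_moment_split: "(\<integral>y. (c \<bullet> y) * F d (x - y) \<partial>M (a + b)) =
      d / (b + d) * (\<integral>u. (c \<bullet> u) * F (b + d) (x - u) \<partial>M a) +
      b / (b + d) * (c \<bullet> x) * (\<integral>u. F (b + d) (x - u) \<partial>M a)"
proof -
  interpret pair_sigma_finite "M a" "M b"
    using pos by (intro pair_sigma_finite_M)
  let ?J = "\<lambda>u. \<integral>v. (c \<bullet> (u + v)) * F d (x - (u + v)) \<partial>M b"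
  let ?K = "\<lambda>u. d / (b + d) * ((c \<bullet> u) * F (b + d) (x - u)) + b / (b + d) * (c \<bullet> x) * F (b + d) (x - u)"
  have J: "integrable (M a) ?J"
    by (rule integrable_fst[OF integrable_M_add[OF pos(1,2) moment]])
  \<comment> \<open>The almost-everywhere formulas for times \<open>b\<close> and \<open>d\<close>
    are used at \<open>x - u\<close>. The exceptional \<open>u\<close> form a null set, also for
    \<open>M a\<close>, so no exceptional \<open>x\<close> remains after integration.\<close>
  have "AE u in lborel. ?J u = ?K u"
    using AE_lborel_reflect[OF AE_conv[OF pos(2,3)], of x]
      AE_lborel_reflect[OF AE_moment_conv[OF pos(2,3)], of x]
  proof eventually_elim
    case (elim u)
    have "?J u = (\<integral>v. (c \<bullet> u) * F d (x - u - v) + (c \<bullet> v) * F d (x - u - v) \<partial>M b)"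
      by (simp add: inner_add_right distrib_right diff_diff_eq)
    also have "\<dots> = (c \<bullet> u) * F (b + d) (x - u) + b / (b + d) * (c \<bullet> (x - u)) * F (b + d) (x - u)"
      using elim by (subst Bochner_Integration.integral_add) auto
    also have "\<dots> = ((c \<bullet> u) + b / (b + d) * (c \<bullet> (x - u))) * F (b + d) (x - u)"
      by (simp add: distrib_right)
    also have "(c \<bullet> u) + b / (b + d) * (c \<bullet> (x - u)) = d / (b + d) * (c \<bullet> u) + b / (b + d) * (c \<bullet> x)"
    proof -
      define q where "q = b / (b + d)"
      have q: "d / (b + d) = 1 - q"
        using pos by (simp add: q_def field_simps)
      show ?thesis
        unfolding q_def[symmetric] q by (simp add: inner_diff_right algebra_simps)
    qed
    finally show ?case
      by (simp add: distrib_right)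
  qed
  then have ae: "AE u in M a. ?J u = ?K u"
    by (subst AE_density) (auto elim: eventually_mono)
  with J have K: "integrable (M a) ?K"
    by (subst (asm) integrable_cong_AE[where g = ?K]) auto
  \<comment> \<open>Subtracting the mass term leaves the desired integrand times the positive factor
    \<open>d / (b + d)\<close>.\<close>
  from Bochner_Integration.integrable_diff[OF K integrable_mult_right[OF mass, of "b / (b + d) * (c \<bullet> x)"]]
  have "integrable (M a) (\<lambda>u. d / (b + d) * ((c \<bullet> u) * F (b + d) (x - u)))"
    by simp
  from integrable_mult_right[OF this, of "(b + d) / d"]
  show fin: "integrable (M a) (\<lambda>u. (c \<bullet> u) * F (b + d) (x - u))"
    using pos by (simp flip: mult.assoc)
  have "(\<integral>y. (c \<bullet> y) * F d (x - y) \<partial>M (a + b)) = (\<integral>u. ?J u \<partial>M a)"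
    by (rule integral_M_add[OF pos(1,2) moment])
  also have "\<dots> = (\<integral>u. ?K u \<partial>M a)"
    using ae by (intro integral_cong_AE) auto
  also have "\<dots> = d / (b + d) * (\<integral>u. (c \<bullet> u) * F (b + d) (x - u) \<partial>M a) +
      b / (b + d) * (c \<bullet> x) * (\<integral>u. F (b + d) (x - u) \<partial>M a)"
    using fin mass by (subst Bochner_Integration.integral_add) auto
  finally show "(\<integral>y. (c \<bullet> y) * F d (x - y) \<partial>M (a + b)) =
      d / (b + d) * (\<integral>u. (c \<bullet> u) * F (b + d) (x - u) \<partial>M a) +
      b / (b + d) * (c \<bullet> x) * (\<integral>u. F (b + d) (x - u) \<partial>M a)" .
qed

text \<open>When its mass is finite and positive, \<open>F a y * F b (x - y)\<close> normalises to
  the density of the increment over time \<open>a\<close>, given the total increment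
  \<open>x\<close> over time \<open>a + b\<close>.\<close>

definition bridge_integrable :: "real \<Rightarrow> real \<Rightarrow> 'a \<Rightarrow> bool" where
  "bridge_integrable a b x \<longleftrightarrow>
     integrable (M a) (\<lambda>y. F b (x - y)) \<and> integrable (M a) (\<lambda>y. (c \<bullet> y) * F b (x - y))"

text \<open>The longer first time hands its surplus to the other factor through
  \<open>nn_integral_conv_assoc\<close>.\<close>

lemma nn_integral_conv_eq:
  assumes "0 < a" "0 < b" "0 < a'" "0 < b'" "a + b = a' + b'"
  shows "(\<integral>\<^sup>+y. ennreal (F b (x - y)) \<partial>M a) = (\<integral>\<^sup>+y. ennreal (F b' (x - y)) \<partial>M a')"
proof (cases a a' rule: linorder_cases)
  case less
  have b: "b = a' - a + b'"
    using assms by simp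
  show ?thesis
    unfolding b using nn_integral_conv_assoc[of a "a' - a" b' x] less assms by simp
next
  case greater
  have b': "b' = a - a' + b"
    using assms by simp
  show ?thesis
    unfolding b' using nn_integral_conv_assoc[of a' "a - a'" b x] greater assms by simp
next
  case equal
  then show ?thesis
    using assms by simp
qed

lemma
  assumes "0 < a" "0 < b" "0 < a'" "0 < b'" "a + b = a' + b'"
  shows integrable_conv_eq:
      "integrable (M a) (\<lambda>y. F b (x - y)) \<longleftrightarrow> integrable (M a') (\<lambda>y. F b' (x - y))"
    and integral_conv_eq: "(\<integral>y. F b (x - y) \<partial>M a) = (\<integral>y. F b' (x - y) \<partial>M a')"
  using nn_integral_conv_eq[OF assms, of x]
  by (simp_all add: integrable_iff_bounded integral_eq_nn_integral)

lemma
  fixes g :: "'a \<Rightarrow> real"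
  assumes [measurable]: "g \<in> borel_measurable borel"
  shows integrable_conv_commute:
      "integrable (M a) (\<lambda>y. g y * F b (x - y)) \<longleftrightarrow> integrable (M b) (\<lambda>y. g (x - y) * F a (x - y))"
    and integral_conv_commute:
      "(\<integral>y. g y * F b (x - y) \<partial>M a) = (\<integral>y. g (x - y) * F a (x - y) \<partial>M b)"
  using integrable_lborel_reflect[of "\<lambda>y. F a y * (g y * F b (x - y))" x]
    integral_lborel_reflect[of "\<lambda>y. F a y * (g y * F b (x - y))" x]
  by (simp_all add: integrable_M integral_M mult_ac)

text \<open>The reflection \<open>y \<mapsto> x - y\<close> exchanges the factors and turns
  \<open>c \<bullet> y\<close> into \<open>c \<bullet> x - c \<bullet> y\<close>; finite mass
  controls the constant term.\<close>

lemma
  assumes "bridge_integrable a b x"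
  shows bridge_integrable_commute: "bridge_integrable b a x"
    and bridge_moment_commute: "(\<integral>y. (c \<bullet> y) * F a (x - y) \<partial>M b) =
      (c \<bullet> x) * (\<integral>y. F b (x - y) \<partial>M a) - (\<integral>y. (c \<bullet> y) * F b (x - y) \<partial>M a)"
proof -
  have mass: "integrable (M b) (\<lambda>y. F a (x - y))"
    using assms integrable_conv_commute[of "\<lambda>_. 1" a b x] by (simp add: bridge_integrable_def)
  have mom: "integrable (M b) (\<lambda>y. (c \<bullet> (x - y)) * F a (x - y))"
    using assms integrable_conv_commute[of "\<lambda>y. c \<bullet> y" a b x] by (simp add: bridge_integrable_def)
  have eq: "(c \<bullet> y) * F a (x - y) = (c \<bullet> x) * F a (x - y) - (c \<bullet> (x - y)) * F a (x - y)" for y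
    by (simp add: inner_diff_right left_diff_distrib)
  show "bridge_integrable b a x"
    unfolding bridge_integrable_def
    by (subst eq) (intro conjI Bochner_Integration.integrable_diff integrable_mult_right mass mom)
  have "(\<integral>y. (c \<bullet> y) * F a (x - y) \<partial>M b) =
      (\<integral>y. (c \<bullet> x) * F a (x - y) \<partial>M b) - (\<integral>y. (c \<bullet> (x - y)) * F a (x - y) \<partial>M b)"
    by (subst eq) (intro Bochner_Integration.integral_diff integrable_mult_right mass mom)
  then show "(\<integral>y. (c \<bullet> y) * F a (x - y) \<partial>M b) =
      (c \<bullet> x) * (\<integral>y. F b (x - y) \<partial>M a) - (\<integral>y. (c \<bullet> y) * F b (x - y) \<partial>M a)"
    using integral_conv_commute[of "\<lambda>_. 1" a b x] integral_conv_commute[of "\<lambda>y. c \<bullet> y" a b x]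
    by simp
qed

lemma bridge_integrable_mono:
  assumes "bridge_integrable a b x" "0 < s" "s < a" "0 < b"
  shows "bridge_integrable s (a - s + b) x"
proof -
  have mass: "integrable (M s) (\<lambda>y. F (a - s + b) (x - y))"
    using assms integrable_conv_eq[of s "a - s + b" a b x] by (simp add: bridge_integrable_def)
  with bridge_moment_mono[of s "a - s" b x] assms show ?thesis
    by (simp add: bridge_integrable_def)
qed

text \<open>Shorten the first time to \<open>s\<close>, swap the factors, then shorten the new first
  time to \<open>a'\<close>. The two shortenings need \<open>s < a\<close> and
  \<open>s < b'\<close>.\<close>

lemma bridge_integrable_eq_sum:
  assumes "bridge_integrable a b x" "0 < a" "0 < b" "0 < a'" "0 < b'" "a + b = a' + b'"
  shows "bridge_integrable a' b' x"
proof -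
  define s where "s = min a b' / 2"
  have s: "0 < s" "s < a" "s < b'"
    using assms by (auto simp: s_def min_def)
  then have "bridge_integrable s (a - s + b) x"
    using assms by (intro bridge_integrable_mono) auto
  then have "bridge_integrable (a - s + b) s x"
    by (rule bridge_integrable_commute)
  then have "bridge_integrable a' (a - s + b - a' + s) x"
    using s assms by (intro bridge_integrable_mono) auto
  moreover have "a - s + b - a' + s = b'"
    using assms by simp
  ultimately show ?thesis
    by simp
qed

text \<open>For small \<open>s\<close>, the means of the increments over \<open>s\<close> and over \<open>a + b - s\<close> add up to
  \<open>c \<bullet> x\<close>, and \<open>bridge_moment_split\<close> gives a second linear equation for them.\<close>

lemma bridge_moment:
  assumes int: "bridge_integrable a b x" and ab: "0 < a" "0 < b"
  shows "(\<integral>y. (c \<bullet> y) * F b (x - y) \<partial>M a) = a / (a + b) * (c \<bullet> x) * (\<integral>y. F b (x - y) \<partial>M a)"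
proof -
  \<comment> \<open>This keeps the middle times \<open>a - s\<close> and \<open>T - s - s\<close>
    positive in the two uses of \<open>bridge_moment_split\<close>.\<close>
  define s where "s = min a b / 2"
  define T where "T = a + b"
  have s: "0 < s" "s < a" "s < b"
    using ab by (auto simp: s_def min_def)
  then have T: "0 < T - s" "s < T - s" "0 < T"
    by (auto simp: T_def)
  have int1: "bridge_integrable s (T - s) x" and int2: "bridge_integrable (T - s) s x"
    using int ab s T by (auto intro: bridge_integrable_eq_sum[OF int] simp: T_def)
  define h where "h = (\<integral>y. F b (x - y) \<partial>M a)"
  define k where "k = (\<integral>y. (c \<bullet> y) * F (T - s) (x - y) \<partial>M s)"
  have h: "(\<integral>y. F (T - s) (x - y) \<partial>M s) = h"
    unfolding h_def using ab s T by (intro integral_conv_eq) (auto simp: T_def)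
  have e1: "(\<integral>y. (c \<bullet> y) * F s (x - y) \<partial>M (T - s)) = (c \<bullet> x) * h - k"
    using bridge_moment_commute[OF int1] by (simp add: h k_def)
  have e2: "(\<integral>y. (c \<bullet> y) * F s (x - y) \<partial>M (T - s)) =
      s / (T - s) * k + (T - s - s) / (T - s) * (c \<bullet> x) * h"
    using bridge_moment_split[of s "T - s - s" s x] s T int1 int2
    by (simp add: bridge_integrable_def h k_def)
  have e3: "u * (s / u * k + w / u * (c \<bullet> x) * h) = s * k + w * ((c \<bullet> x) * h)"
    if "0 < u" for u w
    using that by (simp add: field_simps)
  have "(T - s) * ((c \<bullet> x) * h - k) = s * k + (T - s - s) * ((c \<bullet> x) * h)"
    unfolding e1[symmetric] unfolding e2 by (rule e3[OF T(1)])
  then have "T * k = s * ((c \<bullet> x) * h)"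
    by (simp add: algebra_simps)
  then have k: "k = s / T * ((c \<bullet> x) * h)"
    using T by (simp add: field_simps)
  \<comment> \<open>Time \<open>a\<close> is split into \<open>s\<close> and \<open>a - s\<close>,
    which reduces its moment to the known \<open>k\<close>.\<close>
  have "(\<integral>y. (c \<bullet> y) * F b (x - y) \<partial>M a) = b / (T - s) * k + (a - s) / (T - s) * (c \<bullet> x) * h"
  proof -
    have eq: "a - s + b = T - s"
      by (simp add: T_def)
    show ?thesis
      using bridge_moment_split[of s "a - s" b x, unfolded eq] s ab int int1
      by (simp add: bridge_integrable_def h k_def)
  qed
  also have "\<dots> = (b / (T - s) * (s / T) + (a - s) / (T - s)) * ((c \<bullet> x) * h)"
    by (simp add: k distrib_right)
  also have "b / (T - s) * (s / T) + (a - s) / (T - s) = a / T"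
  proof -
    have "b * s + (a - s) * T = a * (T - s)"
      by (simp add: T_def algebra_simps)
    moreover have "b / u * (s / T) + (a - s) / u = (b * s + (a - s) * T) / (u * T)" if "0 < u" for u
      using T that by (simp add: field_simps)
    ultimately show ?thesis
      using T by simp
  qed
  finally show ?thesis
    by (simp add: h_def T_def)
qed

section \<open>Almost every time and point\<close>

lemma AE_bridge_integrable:
  "AE (l, x) in lborel \<Otimes>\<^sub>M lborel. 0 < l \<longrightarrow> 0 < c \<bullet> x \<longrightarrow>
     bridge_integrable l (c \<bullet> x) x \<and>
     (\<integral>\<^sup>+y. ennreal (F (c \<bullet> x) (x - y)) \<partial>M l) = ennreal (F (l + c \<bullet> x) x)"
proof -
  have pair: "pair_sigma_finite (lborel :: real measure) (lborel :: 'a measure)" ..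
  \<comment> \<open>\<open>P\<close> states both conclusions at the balanced splitting of
    \<open>T\<close>; for a given \<open>x\<close> they transfer to any splitting into positive
    times with the same sum. Integrals of nonnegative functions over \<open>lborel\<close> make it
    measurable in the pair.\<close>
  define P where "P T x \<longleftrightarrow>
    (\<integral>\<^sup>+y. ennreal (F (T / 2) y) * ennreal (F (T / 2) (x - y)) \<partial>lborel) = ennreal (F T x) \<and>
    (\<integral>\<^sup>+y. ennreal (F (T / 2) y) * ennreal \<bar>(c \<bullet> y) * F (T / 2) (x - y)\<bar> \<partial>lborel) < \<infinity>" for T x
  have [measurable]: "Measurable.pred N (\<lambda>p. P (g p) (k p))"
    if [measurable]: "g \<in> borel_measurable N" "k \<in> borel_measurable N"
    for N :: "(real \<times> 'a) measure" and g k
    unfolding P_def by measurable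
  have cond: "{p \<in> space (lborel \<Otimes>\<^sub>M lborel). 0 < fst p \<longrightarrow> P (fst p) (snd p)} \<in>
      sets (lborel \<Otimes>\<^sub>M lborel)"
    by measurable
  have shear: "{p \<in> space (lborel \<Otimes>\<^sub>M lborel). 0 < fst p + c \<bullet> snd p \<longrightarrow> P (fst p + c \<bullet> snd p) (snd p)} \<in>
      sets (lborel \<Otimes>\<^sub>M lborel)"
    by measurable
  have P: "bridge_integrable (T / 2) (T / 2) x"
    "(\<integral>\<^sup>+y. ennreal (F (T / 2) (x - y)) \<partial>M (T / 2)) = ennreal (F T x)" if "P T x" for T x
    using that unfolding P_def bridge_integrable_def
    by (auto simp: integrable_iff_bounded nn_integral_M)
  have "AE x in lborel. 0 < T \<longrightarrow> P T x" for T
  proof (cases "0 < T")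
    case True
    then have "AE x in lborel. (\<integral>\<^sup>+y. ennreal (F (T / 2) (x - y)) \<partial>M (T / 2)) = ennreal (F T x)"
      "AE x in lborel. integrable (M (T / 2)) (\<lambda>v. (c \<bullet> v) * F (T / 2) (x - v))"
      using AE_nn_integral_conv[of "T / 2" "T / 2"] AE_moment_conv[of "T / 2" "T / 2"]
      by (auto elim: eventually_mono)
    then show ?thesis
      by eventually_elim (auto simp: P_def integrable_iff_bounded nn_integral_M)
  qed simp
  then have "AE T in lborel. AE x in lborel. 0 < T \<longrightarrow> P T x"
    by simp
  then have "AE x in lborel. AE T in lborel. 0 < T \<longrightarrow> P T x"
    unfolding pair_sigma_finite.AE_commute[OF pair cond] .
  \<comment> \<open>For fixed \<open>x\<close> the substitution \<open>T = l + c \<bullet> x\<close>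
    is a translation, which preserves null sets; this is the shear, carried out fibrewise.\<close>
  then have "AE x in lborel. AE l in lborel. 0 < l + c \<bullet> x \<longrightarrow> P (l + c \<bullet> x) x"
    by eventually_elim (rule AE_lborel_translate)
  then have "AE l in lborel. AE x in lborel. 0 < l + c \<bullet> x \<longrightarrow> P (l + c \<bullet> x) x"
    unfolding pair_sigma_finite.AE_commute[OF pair shear] .
  then have "AE (l, x) in lborel \<Otimes>\<^sub>M lborel. 0 < l + c \<bullet> x \<longrightarrow> P (l + c \<bullet> x) x"
    using pair_sigma_finite.AE_pair_measure[OF pair shear] by (simp add: case_prod_beta')
  then show ?thesis
  proof eventually_elim
    case (elim p)
    obtain l x where p: "p = (l, x)"
      by (cases p)
    show ?case
      unfolding p split
    proof (intro impI)
      assume pos: "0 < l" "0 < c \<bullet> x"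
      with elim have "P (l + c \<bullet> x) x"
        by (simp add: p)
      note PT = P[OF this]
      have "bridge_integrable l (c \<bullet> x) x"
        by (rule bridge_integrable_eq_sum[OF PT(1)]) (use pos in auto)
      moreover have "(\<integral>\<^sup>+y. ennreal (F (c \<bullet> x) (x - y)) \<partial>M l) =
          (\<integral>\<^sup>+y. ennreal (F ((l + c \<bullet> x) / 2) (x - y)) \<partial>M ((l + c \<bullet> x) / 2))"
        by (rule nn_integral_conv_eq) (use pos in auto)
      ultimately show "bridge_integrable l (c \<bullet> x) x \<and>
          (\<integral>\<^sup>+y. ennreal (F (c \<bullet> x) (x - y)) \<partial>M l) = ennreal (F (l + c \<bullet> x) x)"
        by (simp only: PT(2) simp_thms)
    qed
  qed
qed

end

section \<open>From the Laplace transform hypothesis to the semigroup setting\<close>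

text \<open>Exponentials \<open>exp (\<theta> \<bullet> x)\<close> are integrable for all small
  \<open>\<theta>\<close>: the zero vector gives finite mass, and small multiples of
  \<open>c\<close> and \<open>- c\<close> dominate \<open>\<bar>c \<bullet> x\<bar>\<close> by way
  of \<open>\<bar>t\<bar> \<le> exp t + exp (- t)\<close>.\<close>

lemma
  fixes \<mu> :: "(real ^ 'n) measure"
  assumes [measurable_cong]: "sets \<mu> = sets borel" and "0 \<in> Theta \<mu>"
  shows finite_measure_of_Theta: "finite_measure \<mu>"
    and integrable_inner_of_Theta: "integrable \<mu> (\<lambda>x. c \<bullet> x)"
proof -
  obtain e where "0 < e" and e: "ball 0 e \<subseteq> {\<theta>. (\<integral>\<^sup>+x. ennreal (exp (\<theta> \<bullet> x)) \<partial>\<mu>) < \<infinity>}"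
    using assms(2) unfolding Theta_def mem_interior by blast
  have exp_integrable: "integrable \<mu> (\<lambda>x. exp (\<theta> \<bullet> x))" if "norm \<theta> < e" for \<theta>
  proof (rule integrableI_bounded)
    have "\<theta> \<in> ball 0 e"
      using that by simp
    with e show "(\<integral>\<^sup>+x. ennreal (norm (exp (\<theta> \<bullet> x))) \<partial>\<mu>) < \<infinity>"
      by auto
  qed measurable
  from exp_integrable[of 0] \<open>0 < e\<close> have "integrable \<mu> (\<lambda>x. 1 :: real)"
    by simp
  then show "finite_measure \<mu>"
    using integrable_iff_bounded[of \<mu> "\<lambda>x. 1 :: real"] by (auto intro: finite_measureI)
  define r where "r = e / (2 * (norm c + 1))"
  have "0 < r"
    using \<open>0 < e\<close> by (simp add: r_def add_nonneg_pos)
  have "r * norm c < e"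
  proof -
    have "r * norm c \<le> r * (norm c + 1)"
      using \<open>0 < r\<close> by simp
    also have "\<dots> = e / 2"
      by (simp add: r_def field_simps add_nonneg_eq_0_iff)
    finally show ?thesis
      using \<open>0 < e\<close> by simp
  qed
  then have int: "integrable \<mu> (\<lambda>x. exp ((r *\<^sub>R c) \<bullet> x) / r + exp ((- r *\<^sub>R c) \<bullet> x) / r)"
    using \<open>0 < r\<close>
    by (intro Bochner_Integration.integrable_add integrable_divide exp_integrable) simp_all
  have "\<bar>c \<bullet> x\<bar> \<le> exp ((r *\<^sub>R c) \<bullet> x) / r + exp ((- r *\<^sub>R c) \<bullet> x) / r" for x
  proof -
    define t where "t = r * (c \<bullet> x)"
    have "\<bar>t\<bar> \<le> exp t + exp (- t)"
      using exp_ge_add_one_self[of t] exp_ge_add_one_self[of "- t"] exp_gt_zero[of t] exp_gt_zero[of "- t"]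
      by linarith
    then have "r * \<bar>c \<bullet> x\<bar> \<le> exp t + exp (- t)"
      using \<open>0 < r\<close> by (simp add: t_def abs_mult)
    then show ?thesis
      using \<open>0 < r\<close> by (simp add: t_def field_simps)
  qed
  then show "integrable \<mu> (\<lambda>x. c \<bullet> x)"
    by (intro Bochner_Integration.integrable_bound[OF int] AE_I2)
      (simp_all add: order_trans[OF _ abs_ge_self])
qed

text \<open>Values of \<open>f\<close> at nonpositive times are arbitrary; the indicator replaces
  them by 0, which extends nonnegativity and joint measurability to all real times.\<close>

lemma density_semigroup_of_densities:
  fixes \<mu> :: "real \<Rightarrow> (real ^ 'n) measure"
  assumes "convolution_semigroup \<mu>" and Theta: "\<forall>l>0. 0 \<in> Theta (\<mu> l)" and "has_densities \<mu> f"
  shows "density_semigroup (\<lambda>l x. indicator {0<..} l * f l x) c"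
proof
  let ?F = "\<lambda>l x. indicator {0<..} l * f l x"
  have f: "f l \<in> borel_measurable borel" "0 \<le> f l x" "\<mu> l = density lborel (\<lambda>x. ennreal (f l x))"
    if "0 < l" for l x
    using assms(3) that by (auto simp: has_densities_def)
  have \<mu>: "\<mu> l = density lborel (\<lambda>x. ennreal (?F l x))" if "0 < l" for l
    using f(3)[OF that] that by simp
  show "0 \<le> ?F l x" for l x
    using f(2)[of l x] by (auto simp: indicator_def)
  have "(\<lambda>p. indicator ({0<..} \<times> UNIV) p *\<^sub>R (case p of (l, x) \<Rightarrow> f l x)) \<in> borel_measurable borel"
    using assms(3) by (simp add: has_densities_def set_borel_measurable_def)
  also have "(\<lambda>p. indicator ({0<..} \<times> UNIV) p *\<^sub>R (case p of (l, x) \<Rightarrow> f l x)) = case_prod ?F"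
    by (auto simp: fun_eq_iff indicator_def)
  finally show "case_prod ?F \<in> borel_measurable (borel \<Otimes>\<^sub>M borel)"
    by (simp add: borel_prod)
  show "integrable lborel (?F l)" if "0 < l" for l
  proof -
    interpret finite_measure "\<mu> l"
      using Theta that f(3)[OF that] by (intro finite_measure_of_Theta) auto
    have "integrable (density lborel (\<lambda>x. ennreal (f l x))) (\<lambda>x. 1 :: real)"
      using integrable_const[of 1] unfolding f(3)[OF that] .
    then show ?thesis
      using f[OF that] by (subst (asm) integrable_density) (auto simp: that)
  qed
  show "integrable lborel (\<lambda>x. ?F l x * (c \<bullet> x))" if "0 < l" for l
  proof -
    have "integrable (\<mu> l) (\<lambda>x. c \<bullet> x)"
      using Theta that f(3)[OF that] by (intro integrable_inner_of_Theta) auto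
    then show ?thesis
      using f[OF that] unfolding f(3)[OF that]
      by (subst (asm) integrable_density) (auto simp: that)
  qed
  show "distr (density lborel (\<lambda>x. ennreal (?F a x)) \<Otimes>\<^sub>M density lborel (\<lambda>x. ennreal (?F b x))) borel
      (\<lambda>(x, y). x + y) = density lborel (\<lambda>x. ennreal (?F (a + b) x))" if "0 < a" "0 < b" for a b
    using assms(1) that
    unfolding \<mu>[OF that(1), symmetric] \<mu>[OF that(2), symmetric] \<mu>[OF add_pos_pos[OF that], symmetric]
    by (simp add: convolution_semigroup_def convolution_def)
qed

text \<open>A Bochner integral is 0 by convention when the integrand is not integrable, so the
  pointwise identity is asserted under integrability and consistency of the density. The second
  conjunct shows that both hold at almost every pair with \<open>l\<close> positive.\<close>

theorem proposition7p1:
  fixes \<mu> :: "real \<Rightarrow> (real ^ 'n) measure"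
    and f :: "real \<Rightarrow> real ^ 'n \<Rightarrow> real"
    and c :: "real ^ 'n"
  assumes "convolution_semigroup \<mu>"
    and "\<forall>l>0. 0 \<in> Theta (\<mu> l)"
    and "has_densities \<mu> f"
    and "c \<noteq> 0"
  shows
    "(\<forall>l>0. \<forall>x.
        (0 < c \<bullet> x \<longrightarrow> density_consistent f l (c \<bullet> x) x) \<longrightarrow>
        integrable lborel (\<lambda>y. p_dens f l 0 y * p_dens f (c \<bullet> y) c (x - y)) \<longrightarrow>
        p_dens f l c x * indicator {0<..} (c \<bullet> x) =
          (\<integral>y. p_dens f l 0 y * p_dens f (c \<bullet> y) c (x - y) \<partial>lborel))
     \<and>
     (AE (l, x) in lborel \<Otimes>\<^sub>M lborel. 0 < l \<longrightarrow>
        (0 < c \<bullet> x \<longrightarrow> density_consistent f l (c \<bullet> x) x) \<and>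
        integrable lborel (\<lambda>y. p_dens f l 0 y * p_dens f (c \<bullet> y) c (x - y)) \<and>
        p_dens f l c x * indicator {0<..} (c \<bullet> x) =
          (\<integral>y. p_dens f l 0 y * p_dens f (c \<bullet> y) c (x - y) \<partial>lborel))"
proof -
  define F where "F = (\<lambda>l x. indicator {0<..} l * f l x)"
  interpret density_semigroup F c
    unfolding F_def by (rule density_semigroup_of_densities[OF assms(1-3)])
  have F: "F l x = f l x" if "0 < l" for l x
    using that by (simp add: F_def)
  let ?g = "\<lambda>l x y. p_dens f l 0 y * p_dens f (c \<bullet> y) c (x - y)"
  \<comment> \<open>Because \<open>c \<bullet> y + c \<bullet> (x - y) = c \<bullet> x\<close>, the
    second factor evaluates \<open>f\<close> at the single time \<open>c \<bullet> x\<close>,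
    whatever \<open>y\<close> is.\<close>
  have g: "?g l x = (\<lambda>y. F l y * ((c \<bullet> y) * F (c \<bullet> x) (x - y)) / (c \<bullet> x))" if "0 < l" "0 < c \<bullet> x" for l x
    using that by (simp add: fun_eq_iff p_dens_def F inner_diff_right)
  have g0: "?g l x = (\<lambda>y. 0)" if "\<not> 0 < c \<bullet> x" for l x
    using that by (simp add: fun_eq_iff p_dens_def inner_diff_right)
  have g_integrable: "integrable lborel (?g l x) \<longleftrightarrow> integrable (M l) (\<lambda>y. (c \<bullet> y) * F (c \<bullet> x) (x - y))"
    if "0 < l" "0 < c \<bullet> x" for l x
    using that by (simp add: g integrable_M divide_inverse)
  have consistent: "density_consistent f l (c \<bullet> x) x \<longleftrightarrow>
      (\<integral>\<^sup>+y. ennreal (F (c \<bullet> x) (x - y)) \<partial>M l) = ennreal (F (l + c \<bullet> x) x)"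
    if "0 < l" "0 < c \<bullet> x" for l x
  proof -
    have "(\<integral>\<^sup>+y. ennreal (F (c \<bullet> x) (x - y)) \<partial>M l) =
        (\<integral>\<^sup>+y. ennreal (f l y) * ennreal (f (c \<bullet> x) (x - y)) \<partial>lborel)"
      by (subst nn_integral_M, measurable) (simp add: F that)
    then show ?thesis
      using that by (auto simp: density_consistent_def F)
  qed
  have main: "p_dens f l c x * indicator {0<..} (c \<bullet> x) = (\<integral>y. ?g l x y \<partial>lborel)"
    if l: "0 < l" and cons: "0 < c \<bullet> x \<Longrightarrow> density_consistent f l (c \<bullet> x) x"
      and int: "integrable lborel (?g l x)" for l x
  proof (cases "0 < c \<bullet> x")
    case True
    \<comment> \<open>Consistency equates the convolution at \<open>x\<close> with a real number,
      which gives both finiteness of the mass and its value.\<close>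
    have "has_bochner_integral (M l) (\<lambda>y. F (c \<bullet> x) (x - y)) (F (l + c \<bullet> x) x)"
      using cons[OF True] consistent[OF l True] by (intro has_bochner_integral_nn_integral) simp_all
    then have mass: "integrable (M l) (\<lambda>y. F (c \<bullet> x) (x - y))"
      "(\<integral>y. F (c \<bullet> x) (x - y) \<partial>M l) = F (l + c \<bullet> x) x"
      by (simp_all add: has_bochner_integral_iff)
    have "bridge_integrable l (c \<bullet> x) x"
      using mass(1) int g_integrable[OF l True] by (simp add: bridge_integrable_def)
    from bridge_moment[OF this l True]
    have "(\<integral>y. (c \<bullet> y) * F (c \<bullet> x) (x - y) \<partial>M l) = l / (l + c \<bullet> x) * (c \<bullet> x) * F (l + c \<bullet> x) x"
      by (simp add: mass(2))
    then have "(\<integral>y. ?g l x y \<partial>lborel) = l / (l + c \<bullet> x) * F (l + c \<bullet> x) x"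
      using True by (simp add: g[OF l True] integral_M)
    then show ?thesis
      using l True by (simp add: p_dens_def F)
  next
    case False
    then show ?thesis
      by (simp add: g0)
  qed
  show ?thesis
  proof (intro conjI allI impI)
    show "p_dens f l c x * indicator {0<..} (c \<bullet> x) = (\<integral>y. ?g l x y \<partial>lborel)"
      if "0 < l" "0 < c \<bullet> x \<longrightarrow> density_consistent f l (c \<bullet> x) x" "integrable lborel (?g l x)" for l x
      using main that by blast
    show "AE (l, x) in lborel \<Otimes>\<^sub>M lborel. 0 < l \<longrightarrow>
        (0 < c \<bullet> x \<longrightarrow> density_consistent f l (c \<bullet> x) x) \<and> integrable lborel (?g l x) \<and>
        p_dens f l c x * indicator {0<..} (c \<bullet> x) = (\<integral>y. ?g l x y \<partial>lborel)"
      using AE_bridge_integrable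
    proof eventually_elim
      case (elim p)
      obtain l x where p: "p = (l, x)"
        by (cases p)
      have "(0 < c \<bullet> x \<longrightarrow> density_consistent f l (c \<bullet> x) x) \<and> integrable lborel (?g l x)" if "0 < l"
      proof (cases "0 < c \<bullet> x")
        case True
        then show ?thesis
          using elim that g_integrable[OF that True] consistent[OF that True]
          by (simp add: p bridge_integrable_def)
      next
        case False
        then show ?thesis
          by (simp add: g0)
      qed
      then show ?case
        unfolding p split using main by blast
    qed
  qed
qed

end
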